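(* If a finite graph $G$ has arboricity $t$, then $B'(G)\le 2tB(G)+t-1$. Moreover, when $t=1$ the inequality is almost sharp: there exist caterpillars $G$ with $B'(G)=2B(G)-1$.
   Context: The arboricity of $G$ is the minimum number of forests whose edge sets partition $E(G)$. A caterpillar is a tree in which the subgraph obtained by deleting all leaves is a path. The bandwidth $B(G)$ is the minimum, over all assignments $g$ of distinct integers to the vertices of $G$, of $\max_{uv\in E(G)}|g(u)-g(v)|$. An edge-numbering of $G$ is an assignment $f$ of distinct integers to the edges; $B'(f)$ is the maximum of $|f(e)-f(e')|$ over pairs of distinct incident edges $e,e'$. The edge-bandwidth $B'(G)$ is the minimum of $B'(f)$ over all edge-numberings $f$ of $G$. *)

theory Defs
  imports Main "HOL-Library.Disjoint_Sets"
begin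

text \<open>Finite simple graphs, given by a vertex set and a set of two-element edges.\<close>

definition finite_graph :: "'a set \<Rightarrow> 'a set set \<Rightarrow> bool" where
  "finite_graph V E \<longleftrightarrow> finite V \<and> (\<forall>e\<in>E. e \<subseteq> V \<and> card e = 2)"

definition adj :: "'a set set \<Rightarrow> 'a \<Rightarrow> 'a \<Rightarrow> bool" where
  "adj E u v \<longleftrightarrow> {u, v} \<in> E"

definition is_cycle :: "'a set set \<Rightarrow> 'a list \<Rightarrow> bool" where
  "is_cycle E xs \<longleftrightarrow>
     3 \<le> length xs \<and> distinct xs \<and> successively (adj E) xs \<and> adj E (last xs) (hd xs)"

definition is_forest :: "'a set \<Rightarrow> 'a set set \<Rightarrow> bool" where
  "is_forest V E \<longleftrightarrow> finite_graph V E \<and> (\<nexists>xs. is_cycle E xs)"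

definition is_tree :: "'a set \<Rightarrow> 'a set set \<Rightarrow> bool" where
  "is_tree V E \<longleftrightarrow> is_forest V E \<and> V \<noteq> {} \<and> (\<forall>u\<in>V. \<forall>v\<in>V. (adj E)\<^sup>*\<^sup>* u v)"

definition is_path_graph :: "'a set \<Rightarrow> 'a set set \<Rightarrow> bool" where
  "is_path_graph V E \<longleftrightarrow>
     (\<exists>xs. distinct xs \<and> V = set xs \<and> E = {{xs ! i, xs ! Suc i} | i. Suc i < length xs})"

definition leaves :: "'a set \<Rightarrow> 'a set set \<Rightarrow> 'a set" where
  "leaves V E = {v \<in> V. card {e \<in> E. v \<in> e} = 1}"

text \<open>The list in \<^const>\<open>is_path_graph\<close> may be empty, so the single-edge tree, of which nothing
  is left after deleting its leaves, counts as a caterpillar.\<close>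

definition is_caterpillar :: "'a set \<Rightarrow> 'a set set \<Rightarrow> bool" where
  "is_caterpillar V E \<longleftrightarrow>
     is_tree V E \<and> is_path_graph (V - leaves V E) {e \<in> E. e \<subseteq> V - leaves V E}"

text \<open>The blocks of a \<^const>\<open>partition_on\<close> are nonempty, which does not affect the minimum;
  an edgeless graph has arboricity 0.\<close>

definition arboricity :: "'a set \<Rightarrow> 'a set set \<Rightarrow> nat" where
  "arboricity V E = (LEAST k. \<exists>P. partition_on E P \<and> card P = k \<and> (\<forall>F\<in>P. is_forest V F))"

text \<open>In the two maxima below, inserting 0 only fixes the value when there is no pair to maximise
  over.\<close>

definition numbering_width :: "'a set set \<Rightarrow> ('a \<Rightarrow> int) \<Rightarrow> nat" where
  "numbering_width E g = Max (insert 0 {nat \<bar>g u - g v\<bar> | u v. {u, v} \<in> E})"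

definition bandwidth :: "'a set \<Rightarrow> 'a set set \<Rightarrow> nat" where
  "bandwidth V E = (LEAST k. \<exists>g. inj_on g V \<and> numbering_width E g = k)"

definition edge_numbering_width :: "'a set set \<Rightarrow> ('a set \<Rightarrow> int) \<Rightarrow> nat" where
  "edge_numbering_width E f =
     Max (insert 0 {nat \<bar>f e - f e'\<bar> | e e'. e \<in> E \<and> e' \<in> E \<and> e \<noteq> e' \<and> e \<inter> e' \<noteq> {}})"

definition edge_bandwidth :: "'a set set \<Rightarrow> nat" where
  "edge_bandwidth E = (LEAST k. \<exists>f. inj_on f E \<and> edge_numbering_width E f = k)"

end

theory Submission
  imports Defs
begin

text \<open>In a forest the edges can be matched injectively to one of their endpoints (the child, once
  every component is rooted). If the edges of a graph are split into \<open>t\<close> forests and \<open>g\<close> numbers the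
  vertices, give the edge matched to \<open>v\<close> in the \<open>i\<close>-th forest the number \<open>t * g v + i\<close>. The vertices
  matched to two incident edges are at distance at most 2, which yields the bound. The stars with
  \<open>2 * k\<close> edges have bandwidth \<open>k\<close> and edge-bandwidth \<open>2 * k - 1\<close>.\<close>

section \<open>Widths as pairwise bounds, and attainment of the minima\<close>

lemma finite_graph_finite_edges:
  assumes "finite_graph V E"
  shows "finite E"
proof (rule finite_subset)
  show "E \<subseteq> Pow V" "finite (Pow V)"
    using assms by (auto simp: finite_graph_def)
qed

text \<open>\<open>Max\<close> is informative only on a finite set. The differences form part of the
  image of the finite set \<open>V \<times> V\<close>, and the inserted 0 never exceeds the natural
  number \<open>k\<close>, so only the pairwise bounds remain.\<close>

lemma numbering_width_le_iff:
  assumes "finite_graph V E"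
  shows "numbering_width E g \<le> k \<longleftrightarrow> (\<forall>u v. {u, v} \<in> E \<longrightarrow> \<bar>g u - g v\<bar> \<le> int k)"
proof -
  let ?S = "{nat \<bar>g u - g v\<bar> | u v. {u, v} \<in> E}"
  have "?S \<subseteq> (\<lambda>(u, v). nat \<bar>g u - g v\<bar>) ` (V \<times> V)"
    using assms by (fastforce simp: finite_graph_def)
  then have "finite ?S"
    using assms by (meson finite_SigmaI finite_graph_def finite_imageI finite_subset)
  then have "numbering_width E g \<le> k \<longleftrightarrow> (\<forall>x\<in>?S. x \<le> k)"
    unfolding numbering_width_def by simp
  also have "\<dots> \<longleftrightarrow> (\<forall>u v. {u, v} \<in> E \<longrightarrow> nat \<bar>g u - g v\<bar> \<le> k)"
    by blast
  finally show ?thesis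
    by (simp add: nat_le_iff)
qed

lemma edge_numbering_width_le_iff:
  assumes "finite E"
  shows "edge_numbering_width E f \<le> k \<longleftrightarrow>
    (\<forall>e\<in>E. \<forall>e'\<in>E. e \<noteq> e' \<and> e \<inter> e' \<noteq> {} \<longrightarrow> \<bar>f e - f e'\<bar> \<le> int k)"
proof -
  let ?S = "{nat \<bar>f e - f e'\<bar> | e e'. e \<in> E \<and> e' \<in> E \<and> e \<noteq> e' \<and> e \<inter> e' \<noteq> {}}"
  have "?S \<subseteq> (\<lambda>(u, v). nat \<bar>f u - f v\<bar>) ` (E \<times> E)"
    by fastforce
  then have "finite ?S"
    using assms by (meson finite_SigmaI finite_imageI finite_subset)
  then have "edge_numbering_width E f \<le> k \<longleftrightarrow> (\<forall>x\<in>?S. x \<le> k)"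
    unfolding edge_numbering_width_def by simp
  also have "\<dots> \<longleftrightarrow>
      (\<forall>e\<in>E. \<forall>e'\<in>E. e \<noteq> e' \<and> e \<inter> e' \<noteq> {} \<longrightarrow> nat \<bar>f e - f e'\<bar> \<le> k)"
    by blast
  finally show ?thesis
    by (simp add: nat_le_iff)
qed

lemma finite_ex_inj_on_int:
  assumes "finite A"
  obtains g :: "'a \<Rightarrow> int" where "inj_on g A"
proof -
  from assms obtain h :: "'a \<Rightarrow> nat" where "inj_on h A"
    using finite_imp_inj_to_nat_seg by blast
  then have "inj_on (\<lambda>x. int (h x)) A"
    by (simp add: inj_on_def)
  then show thesis
    by (rule that)
qed

text \<open>\<open>LEAST\<close> carries information only once some value qualifies. A finite vertex
  set has an injective integer numbering, whose width is such a value.\<close>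

lemma bandwidth_attained:
  assumes "finite V"
  obtains g where "inj_on g V" "numbering_width E g = bandwidth V E"
proof -
  obtain g0 :: "'a \<Rightarrow> int" where "inj_on g0 V"
    using assms by (rule finite_ex_inj_on_int)
  then have "\<exists>k g. inj_on g V \<and> numbering_width E g = k"
    by blast
  then have "\<exists>g. inj_on g V \<and> numbering_width E g = bandwidth V E"
    unfolding bandwidth_def by (rule LeastI_ex)
  then show thesis
    using that by blast
qed

lemma bandwidth_le: "inj_on g V \<Longrightarrow> bandwidth V E \<le> numbering_width E g"
  unfolding bandwidth_def by (rule Least_le) blast

lemma edge_bandwidth_attained:
  assumes "finite E"
  obtains f where "inj_on f E" "edge_numbering_width E f = edge_bandwidth E"
proof -
  obtain f0 :: "'a set \<Rightarrow> int" where "inj_on f0 E"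
    using assms by (rule finite_ex_inj_on_int)
  then have "\<exists>k f. inj_on f E \<and> edge_numbering_width E f = k"
    by blast
  then have "\<exists>f. inj_on f E \<and> edge_numbering_width E f = edge_bandwidth E"
    unfolding edge_bandwidth_def by (rule LeastI_ex)
  then show thesis
    using that by blast
qed

lemma edge_bandwidth_le: "inj_on f E \<Longrightarrow> edge_bandwidth E \<le> edge_numbering_width E f"
  unfolding edge_bandwidth_def by (rule Least_le) blast

section \<open>Cycles, forests and the matching of edges to endpoints\<close>

lemma not_is_cycle_common_vertex:
  assumes "\<forall>e\<in>E. c \<in> e"
  shows "\<not> is_cycle E xs"
proof
  assume cyc: "is_cycle E xs"
  then obtain x y z zs where xs: "xs = x # y # z # zs"
    by (auto simp: is_cycle_def numeral_3_eq_3 Suc_le_length_iff)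
  have edges: "{x, y} \<in> E" "{y, z} \<in> E" "{last (z # zs), x} \<in> E" and "distinct xs"
    using cyc by (auto simp: is_cycle_def adj_def xs)
  have "last (z # zs) \<in> set (z # zs)"
    by (rule last_in_set) simp
  \<comment> \<open>Since \<open>x\<close> and \<open>z\<close> differ, the first two edges share
    only \<open>y\<close>, so \<open>c\<close> would be \<open>y\<close>. The closing edge misses
    \<open>y\<close>.\<close>
  then have "last (z # zs) \<noteq> y" "x \<noteq> y" "x \<noteq> z"
    using \<open>distinct xs\<close> unfolding xs by auto
  moreover have "c \<in> {x, y}" "c \<in> {y, z}" "c \<in> {last (z # zs), x}"
    using assms edges by (simp_all only: Ball_def)
  ultimately show False
    by (metis empty_iff insert_iff)
qed

lemma is_cycle_mono: "is_cycle E xs \<Longrightarrow> E \<subseteq> F \<Longrightarrow> is_cycle F xs"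
  unfolding is_cycle_def adj_def by (auto elim: successively_mono)

lemma is_forest_subset: "is_forest V F \<Longrightarrow> E \<subseteq> F \<Longrightarrow> is_forest V E"
  unfolding is_forest_def finite_graph_def using is_cycle_mono by blast

text \<open>An end vertex of a longest path has degree 1.\<close>

lemma forest_ex_leaf_edge:
  assumes "is_forest V E" "E \<noteq> {}"
  obtains v e where "{e' \<in> E. v \<in> e'} = {e}"
proof -
  have fin: "finite V" and edges: "\<And>e. e \<in> E \<Longrightarrow> e \<subseteq> V \<and> card e = 2"
    and acyclic: "\<And>xs. \<not> is_cycle E xs"
    using assms by (auto simp: is_forest_def finite_graph_def)
  define P where
    "P xs \<longleftrightarrow> 2 \<le> length xs \<and> distinct xs \<and> set xs \<subseteq> V \<and> successively (adj E) xs" for xs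
  obtain e0 where "e0 \<in> E"
    using assms(2) by blast
  moreover obtain a b where "e0 = {a, b}" "a \<noteq> b"
    using edges[OF \<open>e0 \<in> E\<close>] by (auto simp: card_2_iff)
  ultimately have "P [a, b]"
    using edges[OF \<open>e0 \<in> E\<close>] by (simp add: P_def adj_def)
  \<comment> \<open>A path without repeated vertices has at most \<open>card V\<close> entries, so a
    longest one exists.\<close>
  moreover have "length xs \<le> card V" if "P xs" for xs
    using that fin by (metis P_def card_mono distinct_card)
  then have "\<forall>xs. P xs \<longrightarrow> length xs < Suc (card V)"
    by (simp add: less_Suc_eq_le)
  ultimately have "\<exists>xs. P xs \<and> (\<forall>ys. P ys \<longrightarrow> length ys \<le> length xs)"
    by (rule ex_has_greatest_nat)
  then obtain xs where xs: "P xs" and longest: "\<And>ys. P ys \<Longrightarrow> length ys \<le> length xs"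
    by (elim exE conjE) simp
  obtain x y zs where xs_eq: "xs = x # y # zs"
    using xs by (auto simp: P_def numeral_2_eq_2 Suc_le_length_iff)
  \<comment> \<open>Let \<open>z\<close> be the other end of an edge at \<open>x\<close>. If
    \<open>z\<close> were off the path, prepending it would give a longer path; if it lay beyond
    \<open>y\<close>, the edge would close a cycle. Hence \<open>z\<close> is
    \<open>y\<close>.\<close>
  have "e = {x, y}" if "e \<in> E" "x \<in> e" for e
  proof -
    obtain z where z: "e = {x, z}" "z \<noteq> x"
      using edges[OF \<open>e \<in> E\<close>] \<open>x \<in> e\<close> by (auto simp: card_2_iff doubleton_eq_iff)
    have "z \<in> V" "adj E z x"
      using edges[OF \<open>e \<in> E\<close>] \<open>e \<in> E\<close> z by (auto simp: adj_def insert_commute)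
    have "z \<in> set xs"
    proof (rule ccontr)
      assume "z \<notin> set xs"
      then have "P (z # xs)"
        using xs \<open>z \<in> V\<close> \<open>adj E z x\<close> by (auto simp: P_def xs_eq)
      then show False
        using longest by fastforce
    qed
    moreover have "z \<notin> set zs"
    proof
      assume "z \<in> set zs"
      \<comment> \<open>The part of the path from \<open>x\<close> up to \<open>z\<close> has at
        least the three vertices \<open>x\<close>, \<open>y\<close>, \<open>z\<close>, and the edge
        from \<open>z\<close> to \<open>x\<close> closes it.\<close>
      then obtain us ws where zs: "zs = us @ z # ws"
        by (meson split_list)
      have "successively (adj E) ((x # y # us @ [z]) @ ws)"
        using xs by (simp add: P_def xs_eq zs)
      then have "successively (adj E) (x # y # us @ [z])"
        unfolding successively_append_iff by blast
      then have "is_cycle E (x # y # us @ [z])"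
        using xs \<open>adj E z x\<close> by (auto simp: is_cycle_def P_def xs_eq zs)
      then show False
        using acyclic by blast
    qed
    ultimately show ?thesis
      using z by (auto simp: xs_eq)
  qed
  moreover have "{x, y} \<in> E"
    using xs by (simp add: P_def xs_eq adj_def)
  ultimately have "{e' \<in> E. x \<in> e'} = {{x, y}}"
    by blast
  then show thesis
    by (rule that)
qed

text \<open>Induction by removing an edge \<open>e\<close> with an end \<open>v\<close> of degree 1,
  so no root has to be chosen. Matching \<open>e\<close> to \<open>v\<close> preserves injectivity:
  every other edge is matched to one of its own endpoints, and \<open>v\<close> is not among
  these.\<close>

lemma forest_ex_inj_endpoint:
  assumes "is_forest V E"
  shows "\<exists>c. inj_on c E \<and> (\<forall>e\<in>E. c e \<in> e)"
  using assms
proof (induction "card E" arbitrary: E)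
  case 0
  then have "E = {}"
    using finite_graph_finite_edges by (fastforce simp: is_forest_def)
  then show ?case
    by simp
next
  case (Suc n)
  then have "E \<noteq> {}"
    by auto
  with Suc.prems obtain v e where ve: "{e' \<in> E. v \<in> e'} = {e}"
    by (rule forest_ex_leaf_edge)
  then have e: "e \<in> E" "v \<in> e" and only: "\<And>e'. e' \<in> E - {e} \<Longrightarrow> v \<notin> e'"
    by auto
  have "n = card (E - {e})"
    using Suc.hyps(2) e by simp
  moreover have "is_forest V (E - {e})"
    using Suc.prems by (rule is_forest_subset) blast
  ultimately obtain c where c: "inj_on c (E - {e})" "\<forall>e'\<in>E - {e}. c e' \<in> e'"
    using Suc.hyps(1) by blast
  have "inj_on (c(e := v)) E"
  proof (rule inj_onI)
    fix e1 e2
    assume "e1 \<in> E" "e2 \<in> E" "(c(e := v)) e1 = (c(e := v)) e2"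
    then show "e1 = e2"
      using c only by (cases "e1 = e"; cases "e2 = e") (auto simp: inj_on_def)
  qed
  moreover have "\<forall>e'\<in>E. (c(e := v)) e' \<in> e'"
    using c(2) e by simp
  ultimately show ?case
    by metis
qed

section \<open>Arboricity and the upper bound\<close>

lemma arboricity_attained:
  assumes "finite_graph V E"
  obtains P where "partition_on E P" "card P = arboricity V E" "\<forall>F\<in>P. is_forest V F"
proof -
  \<comment> \<open>The partition into single edges shows that some number of forests suffices: one
    edge alone cannot carry a cycle.\<close>
  let ?P = "(\<lambda>e. {e}) ` E"
  have "is_forest V {e}" if "e \<in> E" for e
  proof -
    have "e \<noteq> {}"
      using assms that by (fastforce simp: finite_graph_def)
    then obtain c where "\<forall>e'\<in>{e}. c \<in> e'"
      by blast
    then show ?thesis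
      using assms that not_is_cycle_common_vertex[of "{e}" c]
      by (auto simp: is_forest_def finite_graph_def)
  qed
  moreover have "partition_on E ?P"
    by (auto simp: partition_on_def disjoint_def)
  ultimately have "\<exists>k P. partition_on E P \<and> card P = k \<and> (\<forall>F\<in>P. is_forest V F)"
    by (intro exI[of _ "card ?P"] exI[of _ ?P]) auto
  then have "\<exists>P. partition_on E P \<and> card P = arboricity V E \<and> (\<forall>F\<in>P. is_forest V F)"
    unfolding arboricity_def by (rule LeastI_ex)
  then show thesis
    using that by blast
qed

text \<open>Uniqueness of quotient and remainder modulo \<open>t\<close>. It lets the number of an
  edge be decoded into the number of its matched vertex and the index of its forest.\<close>

lemma mult_add_eq_iff_int:
  fixes a b i j t :: int
  assumes "0 \<le> i" "i < t" "0 \<le> j" "j < t"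
  shows "t * a + i = t * b + j \<longleftrightarrow> a = b \<and> i = j"
proof
  assume eq: "t * a + i = t * b + j"
  have "(t * a + i) div t = a" "(t * b + j) div t = b"
    using assms by (simp_all add: div_pos_pos_trivial)
  with eq show "a = b \<and> i = j"
    by auto
qed simp

lemma edge_bandwidth_le_arboricity_bandwidth:
  assumes G: "finite_graph V E"
  shows "edge_bandwidth E \<le> 2 * arboricity V E * bandwidth V E + arboricity V E - 1"
proof (cases "E = {}")
  \<comment> \<open>Without edges the arboricity is 0, and the subtraction on naturals truncates the
    bound to 0. The edge-bandwidth therefore has to be exactly 0 here.\<close>
  case True
  have "edge_bandwidth E \<le> edge_numbering_width E (\<lambda>_. 0)"
    by (rule edge_bandwidth_le) (simp add: True)
  also have "\<dots> = 0"
    by (simp add: True edge_numbering_width_def)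
  finally show ?thesis
    by simp
next
  case False
  define t where "t = arboricity V E"
  define B where "B = bandwidth V E"
  obtain P where P: "partition_on E P" "card P = t" "\<forall>F\<in>P. is_forest V F"
    unfolding t_def using G by (rule arboricity_attained)
  have "finite E"
    using G by (rule finite_graph_finite_edges)
  have "finite P"
    using P(1) \<open>finite E\<close> by (metis finite_elements)
  have "t > 0"
    using P False \<open>finite P\<close> by (auto simp: partition_on_def card_gt_0_iff)
  obtain g where g: "inj_on g V" "numbering_width E g = B"
    unfolding B_def using G by (meson bandwidth_attained finite_graph_def)
  have gB: "\<bar>g u - g v\<bar> \<le> int B" if "{u, v} \<in> E" for u v
    using numbering_width_le_iff[OF G, of g B] g(2) that by simp
  \<comment> \<open>The vertex shared by two incident edges may be the endpoint matched to one of
    them, so the bound has to cover \<open>u = v\<close> as well.\<close>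
  have gB': "\<bar>g u - g v\<bar> \<le> int B" if "e \<in> E" "u \<in> e" "v \<in> e" for e u v
  proof (cases "u = v")
    case False
    have "card e = 2"
      using G that(1) by (simp add: finite_graph_def)
    then have "e = {u, v}"
      using that False by (auto simp: card_2_iff)
    then show ?thesis
      using gB that(1) by blast
  qed simp
  obtain h where h: "bij_betw h P {0..<t}"
    using ex_bij_betw_finite_nat[OF \<open>finite P\<close>] P(2) by auto
  have "\<exists>c. \<forall>F\<in>P. inj_on (c F) F \<and> (\<forall>e\<in>F. c F e \<in> e)"
    using P(3) forest_ex_inj_endpoint by (intro bchoice) blast
  then obtain c where c: "\<And>F. F \<in> P \<Longrightarrow> inj_on (c F) F"
    "\<And>F e. F \<in> P \<Longrightarrow> e \<in> F \<Longrightarrow> c F e \<in> e"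
    by blast
  have "\<forall>e\<in>E. \<exists>F. F \<in> P \<and> e \<in> F"
    using P(1) by (auto simp: partition_on_def)
  then obtain \<phi> where \<phi>: "\<And>e. e \<in> E \<Longrightarrow> \<phi> e \<in> P" "\<And>e. e \<in> E \<Longrightarrow> e \<in> \<phi> e"
    by metis
  define d where "d e = c (\<phi> e) e" for e
  define i where "i e = int (h (\<phi> e))" for e
  define f where "f e = int t * g (d e) + i e" for e
  have d: "d e \<in> e" "d e \<in> V" if "e \<in> E" for e
  proof -
    show "d e \<in> e"
      using c(2) \<phi> that by (simp add: d_def)
    then show "d e \<in> V"
      using that G by (auto simp: finite_graph_def)
  qed
  have i: "0 \<le> i e" "i e < int t" if "e \<in> E" for e
    using bij_betwE[OF h] \<phi>(1)[OF that] by (auto simp: i_def)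
  have "inj_on f E"
  proof (rule inj_onI)
    fix e e'
    assume e: "e \<in> E" "e' \<in> E" and "f e = f e'"
    \<comment> \<open>Decoding gives the same vertex number and the same index. Injectivity of
      \<open>g\<close> and \<open>h\<close> then yields the same matched vertex and the same forest,
      and within one forest the matching is injective.\<close>
    then have "g (d e) = g (d e')" "i e = i e'"
      using mult_add_eq_iff_int i by (simp_all add: f_def)
    then have "d e = d e'" "\<phi> e = \<phi> e'"
      using g(1) d e h \<phi>(1) by (auto simp: inj_on_def i_def bij_betw_def)
    then show "e = e'"
      using c(1)[OF \<phi>(1)[OF e(1)]] \<phi>(2) e by (auto simp: d_def inj_on_def)
  qed
  then have "edge_bandwidth E \<le> edge_numbering_width E f"
    by (rule edge_bandwidth_le)
  also have "\<dots> \<le> 2 * t * B + t - 1"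
    unfolding edge_numbering_width_le_iff[OF \<open>finite E\<close>]
  proof (intro ballI impI)
    fix e e'
    assume e: "e \<in> E" "e' \<in> E" and inc: "e \<noteq> e' \<and> e \<inter> e' \<noteq> {}"
    then obtain w where w: "w \<in> e" "w \<in> e'"
      by blast
    \<comment> \<open>Both matched vertices are compared with the common vertex \<open>w\<close>,
      which gives \<open>2 * B\<close>. The factor \<open>t\<close> scales this, and the forest
      indices add at most \<open>t - 1\<close>.\<close>
    have "\<bar>g (d e) - g w\<bar> \<le> int B" "\<bar>g w - g (d e')\<bar> \<le> int B"
      using gB' d e w by blast+
    then have "\<bar>g (d e) - g (d e')\<bar> \<le> 2 * int B"
      by linarith
    then have "int t * \<bar>g (d e) - g (d e')\<bar> \<le> int t * (2 * int B)"
      by (rule mult_left_mono) simp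
    then have "\<bar>int t * (g (d e) - g (d e'))\<bar> \<le> int t * (2 * int B)"
      by (simp add: abs_mult)
    moreover have "\<bar>i e - i e'\<bar> \<le> int t - 1"
      using i[OF e(1)] i[OF e(2)] by linarith
    moreover have "f e - f e' = int t * (g (d e) - g (d e')) + (i e - i e')"
      by (simp add: f_def right_diff_distrib)
    ultimately have "\<bar>f e - f e'\<bar> \<le> int t * (2 * int B) + int t - 1"
      by linarith
    \<comment> \<open>Positivity of \<open>t\<close> keeps the subtraction on naturals from
      truncating.\<close>
    also have "\<dots> = int (2 * t * B + t - 1)"
      using \<open>t > 0\<close> by (cases t) (simp_all add: algebra_simps)
    finally show "\<bar>f e - f e'\<bar> \<le> int (2 * t * B + t - 1)" .
  qed
  finally show ?thesis
    by (simp add: t_def B_def)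
qed

section \<open>Stars as caterpillars, with their bandwidth and edge-bandwidth\<close>

definition star :: "nat \<Rightarrow> nat set set" where
  "star m = (\<lambda>i. {0, i}) ` {1..m}"

lemma doubleton_in_star_iff:
  "{u, v} \<in> star m \<longleftrightarrow> u = 0 \<and> v \<in> {1..m} \<or> v = 0 \<and> u \<in> {1..m}"
  by (auto simp: star_def doubleton_eq_iff)

lemma finite_graph_star: "finite_graph {0..m} (star m)"
  by (auto simp: finite_graph_def star_def)

lemma card_star: "card (star m) = m"
  unfolding star_def by (subst card_image) (auto simp: inj_on_def doubleton_eq_iff)

lemma is_forest_star: "is_forest {0..m} (star m)"
  using finite_graph_star not_is_cycle_common_vertex[of "star m" 0]
  by (auto simp: is_forest_def star_def)

lemma is_tree_star: "is_tree {0..m} (star m)"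
proof -
  have "(adj (star m))\<^sup>*\<^sup>* u 0" "(adj (star m))\<^sup>*\<^sup>* 0 u" if "u \<in> {0..m}" for u
  proof -
    have "u = 0 \<or> adj (star m) u 0 \<and> adj (star m) 0 u"
      using that by (auto simp: adj_def doubleton_in_star_iff)
    then show "(adj (star m))\<^sup>*\<^sup>* u 0" "(adj (star m))\<^sup>*\<^sup>* 0 u"
      by auto
  qed
  then have "\<forall>u\<in>{0..m}. \<forall>v\<in>{0..m}. (adj (star m))\<^sup>*\<^sup>* u v"
    by (meson rtranclp_trans)
  then show ?thesis
    using is_forest_star by (simp add: is_tree_def)
qed

text \<open>The centre has degree \<open>m\<close>, so \<open>2 \<le> m\<close> is what keeps it
  from being a leaf; in the star with one edge both ends are leaves.\<close>

lemma leaves_star: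
  assumes "2 \<le> m"
  shows "leaves {0..m} (star m) = {1..m}"
proof -
  have "{e \<in> star m. 0 \<in> e} = star m"
    by (auto simp: star_def)
  then have "card {e \<in> star m. 0 \<in> e} \<noteq> 1"
    using assms by (simp add: card_star)
  moreover have "card {e \<in> star m. v \<in> e} = 1" if "v \<in> {1..m}" for v
  proof -
    have "{e \<in> star m. v \<in> e} = {{0, v}}"
      using that by (auto simp: star_def)
    then show ?thesis
      by simp
  qed
  moreover have "{0..m} = insert 0 {1..m}"
    by auto
  ultimately show ?thesis
    by (auto simp: leaves_def)
qed

lemma is_caterpillar_star:
  assumes "2 \<le> m"
  shows "is_caterpillar {0..m} (star m)"
proof -
  have "{0..m} - leaves {0..m} (star m) = {0}"
    using assms by (auto simp: leaves_star)
  moreover have "{e \<in> star m. e \<subseteq> {0}} = {}"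
  proof (rule equals0I)
    fix e
    assume "e \<in> {e \<in> star m. e \<subseteq> {0}}"
    then obtain i where "i \<in> {1..m}" "{0, i} \<subseteq> {0}"
      unfolding star_def by blast
    then show False
      by simp
  qed
  \<comment> \<open>Only the centre survives. The list \<open>[0]\<close> has no consecutive
    entries, so its path has no edges.\<close>
  moreover have "is_path_graph {0::nat} {}"
    unfolding is_path_graph_def by (rule exI[of _ "[0]"]) auto
  ultimately show ?thesis
    using is_tree_star by (simp only: is_caterpillar_def simp_thms)
qed

text \<open>The star is itself a forest, so one block suffices; its edge set is nonempty, so zero
  blocks do not.\<close>

lemma arboricity_star:
  assumes "0 < m"
  shows "arboricity {0..m} (star m) = 1"
proof -
  let ?Q = "\<lambda>k. \<exists>P. partition_on (star m) P \<and> card P = k \<and> (\<forall>F\<in>P. is_forest {0..m} F)"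
  have "star m \<noteq> {}"
    using assms by (auto simp: star_def)
  then have "?Q 1"
    using is_forest_star by (intro exI[of _ "{star m}"]) (auto simp: partition_on_def)
  moreover have "1 \<le> k" if k: "?Q k" for k
  proof -
    obtain P where P: "partition_on (star m) P" "card P = k"
      using k by blast
    have "finite P"
      using P(1) finite_graph_finite_edges[OF finite_graph_star] by (metis finite_elements)
    moreover have "P \<noteq> {}"
      using P(1) \<open>star m \<noteq> {}\<close> by (auto simp: partition_on_def)
    ultimately show ?thesis
      using P(2) by (auto simp: Suc_le_eq card_gt_0_iff)
  qed
  ultimately show ?thesis
    unfolding arboricity_def by (rule Least_equality)
qed

lemma bandwidth_star: "bandwidth {0..2 * k} (star (2 * k)) = k"
proof (rule antisym)
  \<comment> \<open>The centre gets 0, half of the leaves get 1 to \<open>k\<close>, and the other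
    half get -1 to \<open>-k\<close>.\<close>
  define g where "g i = (if i \<le> k then int i else int k - int i)" for i
  have "inj_on g {0..2 * k}"
    by (auto simp: inj_on_def g_def split: if_splits)
  then have "bandwidth {0..2 * k} (star (2 * k)) \<le> numbering_width (star (2 * k)) g"
    by (rule bandwidth_le)
  also have "\<dots> \<le> k"
    unfolding numbering_width_le_iff[OF finite_graph_star]
    by (auto simp: doubleton_in_star_iff g_def)
  finally show "bandwidth {0..2 * k} (star (2 * k)) \<le> k" .
next
  define w where "w = bandwidth {0..2 * k} (star (2 * k))"
  obtain g where g: "inj_on g {0..2 * k}" "numbering_width (star (2 * k)) g = w"
    unfolding w_def by (rule bandwidth_attained[OF finite_atLeastAtMost])
  have "\<bar>g 0 - g v\<bar> \<le> int w" if "v \<in> {0..2 * k}" for v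
  proof (cases "v = 0")
    case False
    then have "{0, v} \<in> star (2 * k)"
      using that by (auto simp: doubleton_in_star_iff)
    then show ?thesis
      using numbering_width_le_iff[OF finite_graph_star, of "2 * k" g w] g(2) by simp
  qed simp
  \<comment> \<open>Counting: \<open>2 * k + 1\<close> distinct values lie in an interval of
    \<open>2 * w + 1\<close> integers centred at \<open>g 0\<close>.\<close>
  then have "g ` {0..2 * k} \<subseteq> {g 0 - int w..g 0 + int w}"
    by (fastforce simp: abs_le_iff)
  then have "card (g ` {0..2 * k}) \<le> card {g 0 - int w..g 0 + int w}"
    by (intro card_mono) simp_all
  then show "k \<le> w"
    using card_image[OF g(1)] by simp
qed

text \<open>All edges meet at the centre, so any two of them are constrained. The task is to place
  \<open>m\<close> distinct integers with the least spread, and consecutive integers are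
  optimal.\<close>

lemma edge_bandwidth_star:
  assumes "0 < m"
  shows "edge_bandwidth (star m) = m - 1"
proof (rule antisym)
  note fin = finite_graph_finite_edges[OF finite_graph_star]
  \<comment> \<open>\<open>Max\<close> recovers the outer vertex of an edge, so the edges are
    numbered 1 to \<open>m\<close>.\<close>
  define f :: "nat set \<Rightarrow> int" where "f e = int (Max e)" for e
  have f: "f {0, i} = int i" for i
    by (simp add: f_def)
  have "inj_on f (star m)"
    by (auto simp: star_def inj_on_def f)
  then have "edge_bandwidth (star m) \<le> edge_numbering_width (star m) f"
    by (rule edge_bandwidth_le)
  also have "\<dots> \<le> m - 1"
    unfolding edge_numbering_width_le_iff[OF fin] by (auto simp: star_def f)
  finally show "edge_bandwidth (star m) \<le> m - 1" .
next
  note fin = finite_graph_finite_edges[OF finite_graph_star]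
  define w where "w = edge_bandwidth (star m)"
  obtain f where f: "inj_on f (star m)" "edge_numbering_width (star m) f = w"
    unfolding w_def using fin by (rule edge_bandwidth_attained)
  have close: "\<bar>f e - f e'\<bar> \<le> int w" if "e \<in> star m" "e' \<in> star m" for e e'
  proof (cases "e = e'")
    case False
    have "e \<inter> e' \<noteq> {}"
      using that by (auto simp: star_def)
    then show ?thesis
      using edge_numbering_width_le_iff[OF fin, of m f w] f(2) that False by simp
  qed simp
  define a where "a = Min (f ` star m)"
  have "star m \<noteq> {}"
    using assms by (auto simp: star_def)
  then have "a \<in> f ` star m"
    unfolding a_def using fin by (intro Min_in) auto
  then obtain e0 where e0: "e0 \<in> star m" "a = f e0"
    by blast
  \<comment> \<open>Measured from the least number \<open>a\<close>, all \<open>m\<close> values fit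
    among \<open>w + 1\<close> integers, hence \<open>m \<le> w + 1\<close>.\<close>
  have "f ` star m \<subseteq> {a..a + int w}"
  proof (rule image_subsetI)
    fix e assume e: "e \<in> star m"
    have "a \<le> f e"
      unfolding a_def using fin e by (intro Min_le) auto
    then show "f e \<in> {a..a + int w}"
      using close[OF e e0(1)] e0(2) by simp
  qed
  then have "card (f ` star m) \<le> card {a..a + int w}"
    by (intro card_mono) simp_all
  then show "m - 1 \<le> w"
    using card_image[OF f(1)] by (simp add: card_star)
qed

theorem theorem9:
  "(\<forall>(V :: 'a set) (E :: 'a set set) (t :: nat).
      finite_graph V E \<and> arboricity V E = t \<longrightarrow>
      edge_bandwidth E \<le> 2 * t * bandwidth V E + t - 1) \<and>
   (\<forall>n :: nat. \<exists>(V :: nat set) (E :: nat set set).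
      is_caterpillar V E \<and> arboricity V E = 1 \<and> n \<le> bandwidth V E \<and>
      int (edge_bandwidth E) = 2 * int (bandwidth V E) - 1)"
proof (intro conjI allI impI)
  fix V :: "'a set" and E :: "'a set set" and t :: nat
  assume "finite_graph V E \<and> arboricity V E = t"
  then show "edge_bandwidth E \<le> 2 * t * bandwidth V E + t - 1"
    using edge_bandwidth_le_arboricity_bandwidth by blast
next
  fix n :: nat
  \<comment> \<open>The successor makes \<open>k\<close> positive, so the star has at least two
    edges, and its bandwidth \<open>k\<close> exceeds the prescribed \<open>n\<close>. Its
    edge-bandwidth \<open>2 * k - 1\<close> is one below the upper bound \<open>2 * k\<close> for
    arboricity 1.\<close>
  define k where "k = Suc n"
  have "is_caterpillar {0..2 * k} (star (2 * k))"
    by (rule is_caterpillar_star) (simp add: k_def)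
  moreover have "arboricity {0..2 * k} (star (2 * k)) = 1"
    by (rule arboricity_star) (simp add: k_def)
  moreover have "n \<le> bandwidth {0..2 * k} (star (2 * k))"
    unfolding bandwidth_star by (simp add: k_def)
  moreover have "int (edge_bandwidth (star (2 * k))) =
      2 * int (bandwidth {0..2 * k} (star (2 * k))) - 1"
    unfolding bandwidth_star by (subst edge_bandwidth_star) (simp_all add: k_def)
  ultimately show "\<exists>(V :: nat set) (E :: nat set set).
      is_caterpillar V E \<and> arboricity V E = 1 \<and> n \<le> bandwidth V E \<and>
      int (edge_bandwidth E) = 2 * int (bandwidth V E) - 1"
    by blast
qed

end
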